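(* Let $\mu$ be a probability measure on $\mathbb{R}^d$ whose mean and covariance matrix $\mathrm{Cov}_\mu$ exist, and let $W:\mathbb{R}^d\to\mathcal{S}_+^d$ satisfy $\int \mathrm{tr}(W)\,\mathrm{d}\mu=\mathrm{tr}(\mathrm{Cov}_\mu)$. Then $C(\mu,W)=1$ if and only if the Riemannian Poincaré inequality becomes an equality for all affine functions, that is, $$\mathrm{Var}_\mu(f)=C(\mu,W)\int \nabla f^\top W\nabla f\,\mathrm{d}\mu\qquad\text{for every affine function } f:\mathbb{R}^d\to\mathbb{R}.$$ In this case, $\int W\,\mathrm{d}\mu=\mathrm{Cov}_\mu$.
   Context: $\mathcal{S}_+^d\subset\mathbb{R}^{d\times d}$ is the convex cone of symmetric positive-semidefinite matrices. For a probability measure $\mu$ on $\mathbb{R}^d$ and a (measurable) matrix field $W:\mathbb{R}^d\to\mathcal{S}_+^d$, the Poincaré constant $C(\mu,W)\in[0,\infty]$ is the smallest constant such that the Riemannian Poincaré inequality $$\mathrm{Var}_\mu(f)\le C(\mu,W)\int \nabla f(x)^\top W(x)\nabla f(x)\,\mathrm{d}\mu(x)$$ holds for every sufficiently smooth $f:\mathbb{R}^d\to\mathbb{R}$, understood here as every continuously differentiable $f$ with $\int f^2\,\mathrm{d}\mu<\infty$ and $\int \nabla f^\top W\nabla f\,\mathrm{d}\mu<\infty$; $\mathrm{Var}_\mu(f)=\int (f-\int f\,\mathrm{d}\mu)^2\,\mathrm{d}\mu$. $\mathrm{Cov}_\mu=\int (x-m)(x-m)^\top\,\mathrm{d}\mu(x)$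 with $m=\int x\,\mathrm{d}\mu$.
   Formalization: The covariance matrix is additionally assumed nonzero, i.e. μ is not a point mass: for a point mass the trace condition makes all variances and energies zero, so C(μ,W)=0 and the affine equality holds although C(μ,W)≠1. *)

theory Defs
  imports "HOL-Probability.Probability"
begin

definition psd_matrix :: "real^'n^'n \<Rightarrow> bool" where
  "psd_matrix A \<longleftrightarrow> transpose A = A \<and> (\<forall>v. 0 \<le> v \<bullet> (A *v v))"

text \<open>
  The definite description is only meaningful where \<open>f\<close> is differentiable.
\<close>

definition gradient :: "(real^'n \<Rightarrow> real) \<Rightarrow> real^'n \<Rightarrow> real^'n" where
  "gradient f x = (THE D. GDERIV f x :> D)"

definition continuously_differentiable :: "(real^'n \<Rightarrow> real) \<Rightarrow> bool" where
  "continuously_differentiable f \<longleftrightarrow>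
     (\<forall>x. f differentiable (at x)) \<and> continuous_on UNIV (gradient f)"

definition affine_function :: "(real^'n \<Rightarrow> real) \<Rightarrow> bool" where
  "affine_function f \<longleftrightarrow> (\<exists>l b. linear l \<and> f = (\<lambda>x. l x + b))"

definition mean_vec :: "(real^'n) measure \<Rightarrow> real^'n" where
  "mean_vec M = (\<integral>x. x \<partial>M)"

text \<open>With \<open>u = x - m\<close> a column vector, the product below is \<open>u u\<^sup>T\<close>.\<close>

definition centred_outer :: "(real^'n) measure \<Rightarrow> real^'n \<Rightarrow> real^'n^'n" where
  "centred_outer M x =
     (columnvector (x - mean_vec M) :: real^1^'n) ** rowvector (x - mean_vec M)"

definition cov_matrix :: "(real^'n) measure \<Rightarrow> real^'n^'n" where
  "cov_matrix M = (\<integral>x. centred_outer M x \<partial>M)"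

text \<open>
  The Bochner integral of a non-integrable function is \<open>0\<close>, so existence of mean and
  covariance has to be required separately.
\<close>

definition has_mean_and_cov :: "(real^'n) measure \<Rightarrow> bool" where
  "has_mean_and_cov M \<longleftrightarrow> integrable M (\<lambda>x. x) \<and> integrable M (centred_outer M)"

text \<open>
  For positive-semidefinite \<open>W\<close> the integrand is nonnegative, so nothing is lost by
  truncating with \<^const>\<open>ennreal\<close>.
\<close>

definition energy ::
    "(real^'n) measure \<Rightarrow> (real^'n \<Rightarrow> real^'n^'n) \<Rightarrow> (real^'n \<Rightarrow> real) \<Rightarrow> ennreal" where
  "energy M W f = (\<integral>\<^sup>+x. ennreal (gradient f x \<bullet> (W x *v gradient f x)) \<partial>M)"

definition test_function ::
    "(real^'n) measure \<Rightarrow> (real^'n \<Rightarrow> real^'n^'n) \<Rightarrow> (real^'n \<Rightarrow> real) \<Rightarrow> bool" where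
  "test_function M W f \<longleftrightarrow>
     continuously_differentiable f \<and> integrable M (\<lambda>x. (f x)\<^sup>2) \<and> energy M W f < \<infinity>"

text \<open>
  In \<^typ>\<open>ennreal\<close> we have \<open>\<infinity> * 0 = 0\<close>, so the set below may be empty; its infimum is then
  \<open>\<infinity>\<close>, as it should be.  A finite infimum is itself an element of the set,
  since all energies that occur are finite.
\<close>

definition poincare_constant ::
    "(real^'n) measure \<Rightarrow> (real^'n \<Rightarrow> real^'n^'n) \<Rightarrow> ennreal" where
  "poincare_constant M W =
     Inf {c. \<forall>f. test_function M W f \<longrightarrow>
               ennreal (prob_space.variance M f) \<le> c * energy M W f}"

end

theory Submission
  imports Defs
begin

text \<open>
  On the affine function \<open>x \<mapsto> v \<bullet> x + b\<close> the variance is the quadratic form of the covariance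
  at \<open>v\<close> and the energy is that of the mean metric \<open>\<integral> W \<partial>\<mu>\<close>.  If the constant is \<open>1\<close>, the
  difference \<open>\<integral> W \<partial>\<mu> - Cov\<close> is therefore positive semidefinite; as its trace vanishes, it is
  zero.  Conversely, adding up the equalities for the coordinate functions gives
  \<open>tr Cov = C * tr Cov\<close> with \<open>0 < tr Cov < \<infinity>\<close>.
\<close>

section \<open>Positive-semidefinite matrices: quadratic form, trace and norm\<close>

lemma bounded_linear_quadratic_form:
  "bounded_linear (\<lambda>A::real^'n^'n. v \<bullet> (A *v v))"
  by (rule linear_conv_bounded_linear[THEN iffD1], rule linearI)
     (simp_all add: matrix_vector_mult_add_rdistrib inner_add_right scaleR_matrix_vector_assoc[symmetric])

lemma bounded_linear_trace: "bounded_linear (trace :: real^'n^'n \<Rightarrow> real)"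
  by (rule linear_conv_bounded_linear[THEN iffD1], rule linearI)
     (simp_all add: trace_def sum.distrib sum_distrib_left)

lemma bounded_linear_transpose: "bounded_linear (transpose :: real^'n^'n \<Rightarrow> real^'n^'n)"
  by (rule linear_conv_bounded_linear[THEN iffD1], rule linearI)
     (simp_all add: transpose_def vec_eq_iff)

lemma inner_axis_mult_axis: "axis i 1 \<bullet> (A *v axis j 1) = (A::real^'n^'n) $ i $ j"
  by (simp add: inner_axis' matrix_vector_mult_basis column_def)

lemma trace_eq_sum_quadratic_form:
  "trace (A::real^'n^'n) = (\<Sum>i\<in>UNIV. axis i 1 \<bullet> (A *v axis i 1))"
  by (simp add: trace_def inner_axis_mult_axis)

text \<open>Testing the form on the sum and the difference of two unit vectors gives
  \<open>2 * \<bar>A $ i $ j\<bar> \<le> A $ i $ i + A $ j $ j\<close>. Each diagonal entry is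
  bounded by the trace separately, which also covers \<open>i = j\<close>.\<close>

lemma psd_matrix_abs_entry_le_trace:
  fixes A :: "real^'n^'n"
  assumes "psd_matrix A"
  shows "\<bar>A $ i $ j\<bar> \<le> trace A"
proof -
  have q: "0 \<le> v \<bullet> (A *v v)" for v
    using assms by (simp add: psd_matrix_def)
  have sym: "A $ j $ i = A $ i $ j"
    using assms unfolding psd_matrix_def transpose_def vec_eq_iff by simp
  have diag: "0 \<le> A $ k $ k" for k
    using q[of "axis k 1"] by (simp add: inner_axis_mult_axis)
  have le: "A $ k $ k \<le> trace A" for k
    unfolding trace_def by (rule member_le_sum) (use diag in auto)
  have "0 \<le> A $ i $ i + A $ j $ j + 2 * A $ i $ j"
    using q[of "axis i 1 + axis j 1"] sym
    by (simp add: matrix_vector_right_distrib inner_add_left inner_add_right inner_axis_mult_axis)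
  moreover have "0 \<le> A $ i $ i + A $ j $ j - 2 * A $ i $ j"
    using q[of "axis i 1 - axis j 1"] sym
    by (simp add: matrix_vector_mult_diff_distrib inner_diff_left inner_diff_right
        inner_axis_mult_axis)
  ultimately show ?thesis
    using le[of i] le[of j] by linarith
qed

lemma psd_matrix_trace_nonneg:
  assumes "psd_matrix A"
  shows "0 \<le> trace A"
  using psd_matrix_abs_entry_le_trace[OF assms] abs_ge_zero order_trans by blast

text \<open>The rigidity behind the equality of \<open>\<integral> W\<close> and the covariance: a
  vanishing trace forces every entry to vanish.\<close>

lemma psd_matrix_trace_eq_0:
  assumes "psd_matrix A" "trace A = 0"
  shows "A = 0"
  using psd_matrix_abs_entry_le_trace[OF assms(1)] assms(2) by (simp add: vec_eq_iff)

text \<open>The Euclidean norm is at most the sum of the absolute values of all entries. The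
  constant is crude, but the bound only has to provide an integrable majorant.\<close>

lemma norm_psd_matrix_le_trace:
  fixes A :: "real^'n^'n"
  assumes "psd_matrix A"
  shows "norm A \<le> real CARD('n) * (real CARD('n) * trace A)"
proof -
  have "norm A \<le> (\<Sum>i\<in>UNIV. norm (A $ i))"
    unfolding norm_vec_def[of A] by (rule L2_set_le_sum) simp
  also have "\<dots> \<le> (\<Sum>i\<in>UNIV. \<Sum>j\<in>UNIV. \<bar>A $ i $ j\<bar>)"
    by (intro sum_mono norm_le_l1_cart)
  also have "\<dots> \<le> (\<Sum>i\<in>(UNIV::'n set). \<Sum>j\<in>(UNIV::'n set). trace A)"
    by (intro sum_mono psd_matrix_abs_entry_le_trace assms)
  finally show ?thesis by simp
qed

section \<open>Integrals of positive-semidefinite matrix fields\<close>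

lemma integrable_psd_matrix:
  fixes W :: "'a \<Rightarrow> real^'n^'n"
  assumes "W \<in> borel_measurable M" "\<And>x. psd_matrix (W x)" "integrable M (\<lambda>x. trace (W x))"
  shows "integrable M W"
proof (rule Bochner_Integration.integrable_bound)
  show "integrable M (\<lambda>x. real CARD('n) * (real CARD('n) * trace (W x)))"
    by (intro integrable_mult_right assms)
  show "AE x in M. norm (W x) \<le> norm (real CARD('n) * (real CARD('n) * trace (W x)))"
    using norm_psd_matrix_le_trace[OF assms(2)] by (auto intro: order_trans[OF _ abs_ge_self])
qed fact

lemma psd_matrix_lebesgue_integral:
  fixes W :: "'a \<Rightarrow> real^'n^'n"
  assumes "integrable M W" "\<And>x. psd_matrix (W x)"
  shows "psd_matrix (\<integral>x. W x \<partial>M)"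
  unfolding psd_matrix_def
proof (intro conjI allI)
  have "transpose (\<integral>x. W x \<partial>M) = (\<integral>x. transpose (W x) \<partial>M)"
    by (rule integral_bounded_linear[OF bounded_linear_transpose assms(1), symmetric])
  also have "\<dots> = (\<integral>x. W x \<partial>M)"
    using assms(2) by (simp add: psd_matrix_def)
  finally show "transpose (\<integral>x. W x \<partial>M) = (\<integral>x. W x \<partial>M)" .
  show "0 \<le> v \<bullet> ((\<integral>x. W x \<partial>M) *v v)" for v
    unfolding integral_bounded_linear[OF bounded_linear_quadratic_form assms(1), symmetric]
    using assms(2) by (intro Bochner_Integration.integral_nonneg) (simp add: psd_matrix_def)
qed

section \<open>Outer products and the covariance matrix\<close>

lemma quadratic_form_centred_outer:
  "v \<bullet> (centred_outer M x *v v) = (v \<bullet> (x - mean_vec M))\<^sup>2"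
proof -
  define u where "u = x - mean_vec M"
  \<comment> \<open>The matrix has rank at most one: it sends \<open>v\<close> to a multiple of
    \<open>u\<close>, so its quadratic form is a perfect square.\<close>
  have "centred_outer M x *v v = (v \<bullet> u) *\<^sub>R u"
    unfolding centred_outer_def u_def[symmetric]
    by (simp add: vec_eq_iff matrix_matrix_mult_def columnvector_def rowvector_def
        matrix_vector_mult_def inner_vec_def sum_distrib_left mult_ac)
  then show ?thesis
    by (simp add: power2_eq_square u_def)
qed

lemma psd_matrix_centred_outer: "psd_matrix (centred_outer M x)"
  by (simp add: psd_matrix_def quadratic_form_centred_outer)
     (simp add: vec_eq_iff transpose_def centred_outer_def matrix_matrix_mult_def
        columnvector_def rowvector_def mult.commute)

lemma psd_matrix_cov_matrix:
  "has_mean_and_cov M \<Longrightarrow> psd_matrix (cov_matrix M)"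
  unfolding cov_matrix_def has_mean_and_cov_def
  by (auto intro: psd_matrix_lebesgue_integral psd_matrix_centred_outer)

section \<open>Variance, energy and admissibility of affine functions\<close>

lemma affine_functionE:
  assumes "affine_function f"
  obtains v b where "f = (\<lambda>x. v \<bullet> x + b)"
proof -
  obtain l b where "linear l" and f: "f = (\<lambda>x. l x + b)"
    using assms by (auto simp: affine_function_def)
  \<comment> \<open>Riesz representation: the adjoint applied to \<open>1\<close> is the
    representing vector.\<close>
  then have "l x = adjoint l 1 \<bullet> x" for x
    using adjoint_works[of l x 1] by (simp add: inner_commute)
  with f show ?thesis
    using that by auto
qed

lemma affine_function_inner: "affine_function (\<lambda>x. v \<bullet> x + b)"
  unfolding affine_function_def
  by (intro exI[of _ "\<lambda>x. v \<bullet> x"] exI[of _ b])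
     (simp add: bounded_linear.linear bounded_linear_inner_right)

text \<open>As \<open>gradient\<close> is a definite description, uniqueness of the derivative has
  to be shown along with its existence.\<close>

lemma gradient_inner: "gradient (\<lambda>x. v \<bullet> x + b) x = v"
proof -
  have d: "GDERIV (\<lambda>x. v \<bullet> x + b) x :> v"
    unfolding gderiv_def by (auto intro!: derivative_eq_intros simp: inner_commute)
  show ?thesis
    unfolding gradient_def
  proof (rule the_equality[where P="\<lambda>D. GDERIV (\<lambda>x. v \<bullet> x + b) x :> D", OF d])
    fix D assume "GDERIV (\<lambda>x. v \<bullet> x + b) x :> D"
    then have "(\<lambda>h. h \<bullet> D) = (\<lambda>h. h \<bullet> v)"
      using d unfolding gderiv_def by (rule has_derivative_unique)
    then show "D = v"
      by (simp add: fun_eq_iff vector_eq_ldot)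
  qed
qed

lemma energy_affine:
  assumes "integrable M W" "\<And>x. psd_matrix (W x)"
  shows "energy M W (\<lambda>x. v \<bullet> x + b) = ennreal (v \<bullet> ((\<integral>x. W x \<partial>M) *v v))"
proof -
  have "energy M W (\<lambda>x. v \<bullet> x + b) = (\<integral>\<^sup>+x. ennreal (v \<bullet> (W x *v v)) \<partial>M)"
    by (simp add: energy_def gradient_inner)
  also have "\<dots> = ennreal (\<integral>x. v \<bullet> (W x *v v) \<partial>M)"
    using assms
    by (intro nn_integral_eq_integral integrable_bounded_linear[OF bounded_linear_quadratic_form])
       (auto simp: psd_matrix_def)
  also have "(\<integral>x. v \<bullet> (W x *v v) \<partial>M) = v \<bullet> ((\<integral>x. W x \<partial>M) *v v)"
    by (rule integral_bounded_linear[OF bounded_linear_quadratic_form assms(1)])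
  finally show ?thesis .
qed

lemma expectation_affine:
  fixes v :: "real^'n"
  assumes "prob_space M" "integrable M (\<lambda>x. x)"
  shows "(\<integral>x. v \<bullet> x + b \<partial>M) = v \<bullet> mean_vec M + b"
proof -
  interpret prob_space M by fact
  show ?thesis
    using assms(2) by (simp add: mean_vec_def prob_space)
qed

lemma variance_affine_eq_cov_matrix:
  fixes v :: "real^'n"
  assumes "prob_space M" and "has_mean_and_cov M"
  shows "prob_space.variance M (\<lambda>x. v \<bullet> x + b) = v \<bullet> (cov_matrix M *v v)"
proof -
  interpret prob_space M by fact
  have mean: "integrable M (\<lambda>x. x)" and cov: "integrable M (centred_outer M)"
    using assms by (auto simp: has_mean_and_cov_def)
  have "variance (\<lambda>x. v \<bullet> x + b) = (\<integral>x. v \<bullet> (centred_outer M x *v v) \<partial>M)"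
    unfolding expectation_affine[OF prob_space_axioms mean]
    by (simp add: quadratic_form_centred_outer inner_diff_right)
  also have "\<dots> = v \<bullet> (cov_matrix M *v v)"
    unfolding cov_matrix_def
    by (rule integral_bounded_linear[OF bounded_linear_quadratic_form cov])
  finally show ?thesis .
qed

lemma integrable_affine_square:
  fixes v :: "real^'n"
  assumes "prob_space M" and "has_mean_and_cov M"
  shows "integrable M (\<lambda>x. (v \<bullet> x + b)\<^sup>2)"
proof -
  interpret prob_space M by fact
  have m: "integrable M (\<lambda>x. x)" and "integrable M (centred_outer M)"
    using assms by (auto simp: has_mean_and_cov_def)
  then have "integrable M (\<lambda>x. (v \<bullet> (x - mean_vec M))\<^sup>2)"
    using integrable_bounded_linear[OF bounded_linear_quadratic_form, of M "centred_outer M" v]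
    by (simp add: quadratic_form_centred_outer)
  \<comment> \<open>Expansion around the mean: the square is integrable by the covariance, the
    linear term by the mean, and the constant because the measure is finite.\<close>
  then have "integrable M (\<lambda>x. (v \<bullet> (x - mean_vec M))\<^sup>2
      + 2 * (v \<bullet> mean_vec M + b) * (v \<bullet> (x - mean_vec M)) + (v \<bullet> mean_vec M + b)\<^sup>2)"
    using m by auto
  also have "(\<lambda>x. (v \<bullet> (x - mean_vec M))\<^sup>2
      + 2 * (v \<bullet> mean_vec M + b) * (v \<bullet> (x - mean_vec M)) + (v \<bullet> mean_vec M + b)\<^sup>2)
    = (\<lambda>x. (v \<bullet> x + b)\<^sup>2)"
    by (simp add: fun_eq_iff inner_diff_right power2_eq_square algebra_simps)
  finally show ?thesis .
qed

lemma test_function_affine: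
  fixes v :: "real^'n"
  assumes "prob_space M" and "has_mean_and_cov M" "integrable M W" "\<And>x. psd_matrix (W x)"
  shows "test_function M W (\<lambda>x. v \<bullet> x + b)"
proof -
  have "gradient (\<lambda>x. v \<bullet> x + b) = (\<lambda>x. v)"
    by (simp add: fun_eq_iff gradient_inner)
  then have "continuously_differentiable (\<lambda>x. v \<bullet> x + b)"
    by (auto simp: continuously_differentiable_def intro!: derivative_intros)
  then show ?thesis
    using assms by (simp add: test_function_def integrable_affine_square energy_affine)
qed

text \<open>A finite infimum is attained: every admissible constant dominates the quotient of
  variance and energy, hence so does the infimum.\<close>

lemma poincare_inequality:
  assumes C: "poincare_constant M W < \<infinity>" and f: "test_function M W f"
  shows "ennreal (prob_space.variance M f) \<le> poincare_constant M W * energy M W f"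
proof (cases "energy M W f = 0")
  case True
  \<comment> \<open>The quotient is useless at energy \<open>0\<close>. Finiteness of the infimum
    yields some admissible \<open>c\<close>, and \<open>c * 0 = 0\<close> makes the variance
    vanish.\<close>
  from C obtain c where "\<forall>f. test_function M W f \<longrightarrow>
      ennreal (prob_space.variance M f) \<le> c * energy M W f"
    unfolding poincare_constant_def by (auto simp: Inf_less_iff)
  with f have "ennreal (prob_space.variance M f) \<le> c * energy M W f"
    by blast
  with True show ?thesis
    by simp
next
  case False
  have fin: "energy M W f \<noteq> \<top>"
    using f by (auto simp: test_function_def)
  have "ennreal (prob_space.variance M f) / energy M W f \<le> poincare_constant M W"
    unfolding poincare_constant_def
  proof (rule Inf_greatest)
    fix c assume "c \<in> {c. \<forall>f. test_function M W f \<longrightarrow>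
      ennreal (prob_space.variance M f) \<le> c * energy M W f}"
    with f have "ennreal (prob_space.variance M f) \<le> c * energy M W f"
      by blast
    then show "ennreal (prob_space.variance M f) / energy M W f \<le> c"
      using False by (intro divide_le_posI_ennreal) (auto simp: mult.commute zero_less_iff_neq_zero)
  qed
  then have "ennreal (prob_space.variance M f) / energy M W f * energy M W f
      \<le> poincare_constant M W * energy M W f"
    by (rule mult_right_mono) simp
  then show ?thesis
    using False fin
    by (simp add: ennreal_divide_times top.not_eq_extremum)
qed

theorem theorem3p1:
  fixes \<mu> :: "(real^'n) measure" and W :: "real^'n \<Rightarrow> real^'n^'n"
  assumes "prob_space \<mu>" and "sets \<mu> = sets borel"
    and "has_mean_and_cov \<mu>"
    and "cov_matrix \<mu> \<noteq> 0"
    and "W \<in> borel_measurable borel" and "\<And>x. psd_matrix (W x)"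
    and "has_bochner_integral \<mu> (\<lambda>x. trace (W x)) (trace (cov_matrix \<mu>))"
  shows "(poincare_constant \<mu> W = 1 \<longleftrightarrow>
           (\<forall>f. affine_function f \<longrightarrow>
              ennreal (prob_space.variance \<mu> f) = poincare_constant \<mu> W * energy \<mu> W f))
         \<and> (poincare_constant \<mu> W = 1 \<longrightarrow> has_bochner_integral \<mu> W (cov_matrix \<mu>))"
proof -
  interpret prob_space \<mu> by fact
  define V where "V = (\<integral>x. W x \<partial>\<mu>)"
  define K where "K = cov_matrix \<mu>"
  define C where "C = poincare_constant \<mu> W"
  have int: "integrable \<mu> W"
  proof (rule integrable_psd_matrix)
    show "W \<in> borel_measurable \<mu>"
      using assms(2,5) measurable_cong_sets by blast
  qed (use assms in \<open>auto simp: has_bochner_integral_iff\<close>)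
  have psdV: "psd_matrix V"
    unfolding V_def using int assms(6) by (rule psd_matrix_lebesgue_integral)
  have psdK: "psd_matrix K"
    unfolding K_def using assms(3) by (rule psd_matrix_cov_matrix)
  have trace_eq: "trace V = trace K"
    using integral_bounded_linear[OF bounded_linear_trace int] assms(7)
    by (simp add: V_def K_def has_bochner_integral_iff)
  have var: "variance (\<lambda>x. v \<bullet> x + b) = v \<bullet> (K *v v)" for v b
    unfolding K_def by (rule variance_affine_eq_cov_matrix[OF assms(1,3)])
  have en: "energy \<mu> W (\<lambda>x. v \<bullet> x + b) = ennreal (v \<bullet> (V *v v))" for v b
    unfolding V_def using int assms(6) by (rule energy_affine)
  have VK: "V = K" if "C = 1"
  proof -
    have "v \<bullet> (K *v v) \<le> v \<bullet> (V *v v)" for v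
    proof -
      \<comment> \<open>The summand \<open>0\<close> keeps the shape in which \<open>var\<close> and
        \<open>en\<close> are stated.\<close>
      have "ennreal (variance (\<lambda>x. v \<bullet> x + 0)) \<le> C * energy \<mu> W (\<lambda>x. v \<bullet> x + 0)"
        unfolding C_def using that
        by (intro poincare_inequality test_function_affine assms int) (simp add: C_def)
      then show ?thesis
        unfolding var en using that psdV by (simp add: psd_matrix_def)
    qed
    then have "psd_matrix (V - K)"
      using psdV psdK
      by (simp add: psd_matrix_def matrix_vector_mult_diff_rdistrib inner_diff_right)
         (simp add: transpose_def vec_eq_iff)
    moreover have "trace (V - K) = 0"
      using trace_eq by (simp add: trace_sub)
    ultimately show ?thesis
      using psd_matrix_trace_eq_0 by fastforce
  qed
  have eq1: "C = 1" if eq: "\<forall>f. affine_function f \<longrightarrow> ennreal (variance f) = C * energy \<mu> W f"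
  proof -
    have nonneg: "0 \<le> v \<bullet> (V *v v)" "0 \<le> v \<bullet> (K *v v)" for v
      using psdV psdK by (auto simp: psd_matrix_def)
    have coord: "ennreal (v \<bullet> (K *v v)) = C * ennreal (v \<bullet> (V *v v))" for v
      using eq[rule_format, OF affine_function_inner[of v 0]] unfolding var en .
    \<comment> \<open>\<open>C\<close> is not yet known to be finite, so the coordinate equalities
      are summed in \<open>ennreal\<close>.\<close>
    have "ennreal (trace K) = (\<Sum>i\<in>UNIV. ennreal (axis i 1 \<bullet> (K *v axis i 1)))"
      unfolding trace_eq_sum_quadratic_form using nonneg by (simp add: sum_ennreal)
    also have "\<dots> = C * (\<Sum>i\<in>UNIV. ennreal (axis i 1 \<bullet> (V *v axis i 1)))"
      by (simp add: coord sum_distrib_left)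
    also have "(\<Sum>i\<in>UNIV. ennreal (axis i 1 \<bullet> (V *v axis i 1))) = ennreal (trace V)"
      unfolding trace_eq_sum_quadratic_form using nonneg by (simp add: sum_ennreal)
    finally have fixpoint: "C * ennreal (trace K) = ennreal (trace K)"
      unfolding trace_eq by (rule sym)
    \<comment> \<open>Here the covariance being nonzero enters: otherwise its trace could not be
      cancelled.\<close>
    have pos: "0 < trace K"
      using psd_matrix_trace_nonneg[OF psdK] psd_matrix_trace_eq_0[OF psdK] assms(4)
      by (auto simp: K_def less_le)
    \<comment> \<open>The divisor is positive and finite, so the cancellation is valid even for an
      infinite \<open>C\<close>.\<close>
    have "C = C * ennreal (trace K) / ennreal (trace K)"
      using pos by (simp add: mult_divide_eq_ennreal)
    also have "\<dots> = 1"
      unfolding fixpoint using pos by simp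
    finally show ?thesis .
  qed
  have eq2: "ennreal (variance f) = C * energy \<mu> W f" if one: "C = 1" and aff: "affine_function f" for f
  proof -
    obtain v b where f: "f = (\<lambda>x. v \<bullet> x + b)"
      using affine_functionE[OF aff] .
    show ?thesis
      unfolding f var en using VK one by simp
  qed
  have "has_bochner_integral \<mu> W (cov_matrix \<mu>)" if "C = 1"
    using VK[OF that] int by (simp add: has_bochner_integral_iff V_def K_def)
  then show ?thesis
    using eq1 eq2 unfolding C_def by blast
qed

end
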